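(* For every integer $n \ge 2$, $$f(n,3) = n+3.$$ For all integers $k \ge 4$ and $n \ge 3$, $$n+k+1 \le f(n,k) \le n + \binom{k}{2}.$$
   Context: Let $Q^n = \{0,1\}^n \subset \mathbb{R}^n$ denote the vertices of the $n$-cube. For positive integers $n, k$, an almost $k$-cover of $Q^n$ is a finite collection (multiset, repetitions allowed and counted with multiplicity) of affine hyperplanes in $\mathbb{R}^n$ such that every vertex of $Q^n \setminus \{\vec{0}\}$ lies in at least $k$ members of the collection (counted with multiplicity), and $\vec{0} = (0,\dots,0)$ lies in none of them. $f(n,k)$ denotes the minimum number of affine hyperplanes (counted with multiplicity) in an almost $k$-cover of $Q^n$. *)

theory Defs
  imports "HOL-Analysis.Analysis" "HOL-Library.Multiset"
begin

definition cube :: "(real^'n) set"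
  where "cube = {x. \<forall>i. x $ i \<in> {0, 1}}"

definition affine_hyperplane :: "(real^'n) set \<Rightarrow> bool"
  where "affine_hyperplane H \<longleftrightarrow> (\<exists>a b. a \<noteq> 0 \<and> H = {x. a \<bullet> x = b})"

definition almost_cover :: "nat \<Rightarrow> (real^'n) set multiset \<Rightarrow> bool"
  where "almost_cover k M \<longleftrightarrow>
    (\<forall>H \<in># M. affine_hyperplane H) \<and>
    (\<forall>v \<in> cube - {0}. k \<le> size {# H \<in># M. v \<in> H #}) \<and>
    (\<forall>H \<in># M. 0 \<notin> H)"

text \<open>
  The minimum size \<open>f(n,k)\<close> of an almost \<open>k\<close>-cover of the \<open>n\<close>-cube. The dimension \<open>n = CARD('n)\<close>
  is passed as a type; the minimum is attained by \<open>almost_cover_exists\<close> below, so that the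
  \<open>LEAST\<close> operator is never applied to an unsatisfiable predicate.
\<close>

definition min_almost_cover :: "'n::finite itself \<Rightarrow> nat \<Rightarrow> nat"
  where "min_almost_cover TYPE('n) k =
    (LEAST m. \<exists>M :: (real^'n) set multiset. almost_cover k M \<and> size M = m)"

lemma almost_cover_exists: "\<exists>M :: (real^'n) set multiset. almost_cover k M"
proof -
  let ?H = "\<lambda>i. {x :: real^'n. x $ i = 1}"
  let ?M = "\<Sum>i\<in>(UNIV :: 'n set). replicate_mset k (?H i)"
  have mem: "\<exists>i. H = ?H i" if "H \<in># ?M" for H
    using that by (auto simp: set_mset_sum split: if_splits)
  have "affine_hyperplane (?H i)" for i
    unfolding affine_hyperplane_def
    by (rule exI[of _ "axis i 1"], rule exI[of _ 1]) (auto simp: inner_axis' axis_eq_0_iff)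
  moreover have "k \<le> size {# H \<in># ?M. v \<in> H #}" if v: "v \<in> cube - {0}" for v
  proof -
    obtain i where i: "v $ i = 1"
      using v by (auto simp: cube_def vec_eq_iff)
    have "replicate_mset k (?H i) \<subseteq># ?M"
      by (simp add: sum.remove[of UNIV i])
    then have "{# H \<in># replicate_mset k (?H i). v \<in> H #} \<subseteq># {# H \<in># ?M. v \<in> H #}"
      by (rule multiset_filter_mono)
    moreover have "{# H \<in># replicate_mset k (?H i). v \<in> H #} = replicate_mset k (?H i)"
      using i by (auto simp: filter_mset_eq_conv split: if_splits)
    ultimately show ?thesis
      by (metis size_mset_mono size_replicate_mset)
  qed
  ultimately have "almost_cover k ?M"
    unfolding almost_cover_def using mem by fastforce
  then show ?thesis ..
qed

end

theory Submission
  imports Defs "HOL-Computational_Algebra.Polynomial"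
begin

text \<open>
  The upper bound comes from a concrete cover: the \<open>n\<close> hyperplanes \<open>x\<^sub>i = 1\<close>, and for each
  \<open>1 \<le> j < k\<close> the hyperplane of all points with coordinate sum \<open>j\<close>, repeated \<open>k - j\<close> times.
  A vertex of weight \<open>j\<close> lies in \<open>j\<close> hyperplanes of the first kind, and the second kind supplies
  the missing \<open>k - j\<close>.

  For the lower bounds it suffices to treat \<open>k = 3\<close> and \<open>k = 4\<close>: deleting one hyperplane from an
  almost \<open>(k + 1)\<close>-cover leaves an almost \<open>k\<close>-cover, so each further unit of \<open>k\<close> costs at least one
  more hyperplane. Multiply the affine equations of the hyperplanes of an almost \<open>k\<close>-cover. The
  product \<open>P\<close> is a polynomial whose degree is the size of the cover; it vanishes to order at
  least \<open>k\<close> at every nonzero vertex, and \<open>P 0 \<noteq> 0\<close>. The proof has two steps.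

  The first step lowers the dimension. Replacing \<open>P x\<close> by \<open>P x - P (x + e\<^sub>i)\<close> lowers the degree by one
  and preserves both properties of \<open>P\<close> on the face \<open>x\<^sub>i = 0\<close> of the cube, because the shifted
  point of a vertex of that face is a nonzero vertex
  (\<open>difference_out_coordinates\<close>). Differencing out all but \<open>m\<close> coordinates turns a
  cover of size \<open>n + r\<close> into a polynomial of degree at most \<open>m + r\<close> in \<open>m\<close> variables. So a
  \<open>3\<close>-cover of size at most \<open>n + 2\<close> gives a polynomial of degree at most \<open>4\<close> in the plane, and a
  \<open>4\<close>-cover of size at most \<open>n + 4\<close> gives one of degree at most \<open>7\<close> in three-space.

  The second step shows that such a polynomial \<open>F\<close> vanishes at \<open>0\<close>. A line through two points at
  which \<open>F\<close> vanishes to order \<open>k\<close> carries \<open>2 k\<close> zeros, which exceeds the degree, so \<open>F\<close> is zero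
  on it. In the plane this makes \<open>F\<close> divisible by the equations of the three lines through
  \<open>(1, 0)\<close>, \<open>(0, 1)\<close>, \<open>(1, 1)\<close>. The quotient is affine, and it still vanishes at these three points, each
  of which lies on only two of the lines; hence it is zero (\<open>vanishes_triangle\<close>). In
  three-space the same argument, with the six lines through the four vertices of a parallelogram,
  shows first that \<open>F\<close> is zero on the plane of any parallelogram of nonzero vertices
  (\<open>vanishes_parallelogram\<close>). There are six such planes, \<open>x\<^sub>i = 1\<close> and \<open>x\<^sub>i + x\<^sub>j = 1\<close>. After division by
  their equations an affine form is left. Each of the points \<open>e\<^sub>1\<close>, \<open>e\<^sub>2\<close>, \<open>e\<^sub>3\<close>, \<open>(1, 1, 1)\<close> lies on
  exactly three of the planes and \<open>F\<close> has order four there, so the affine form vanishes at these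
  four affinely independent points and is zero (\<open>vanishes_3cube\<close>).
\<close>

section \<open>Affine forms and polynomial functions\<close>

definition affine_form :: "('a::real_vector \<Rightarrow> real) \<Rightarrow> bool"
  where "affine_form l \<longleftrightarrow> linear (\<lambda>x. l x - l 0)"

lemma affine_form_line:
  assumes "affine_form l"
  shows "l (x + t *\<^sub>R w) = l x + t * (l w - l 0)"
proof -
  have "linear (\<lambda>x. l x - l 0)"
    using assms by (simp add: affine_form_def)
  from linear_add[OF this, of x "t *\<^sub>R w"] linear_cmul[OF this, of t w] show ?thesis
    by simp
qed

lemma affine_form_affine:
  assumes "affine_form l"
  shows "l (x + t *\<^sub>R (y - z)) = l x + t * (l y - l z)"
proof -
  have "linear (\<lambda>x. l x - l 0)"
    using assms by (simp add: affine_form_def)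
  from linear_diff[OF this, of y z] show ?thesis
    using affine_form_line[OF assms, of x t "y - z"] by simp
qed

lemma affine_form_const: "affine_form (\<lambda>x. c)"
  by (simp add: affine_form_def linear_iff)

lemma affine_form_compose:
  assumes "affine_form l" "linear A"
  shows "affine_form (\<lambda>x. l (u + A x))"
proof -
  have 1: "l (u + y) - l u = l y - l 0" for y
    using affine_form_line[OF assms(1), of u 1 y] by simp
  have "linear (\<lambda>x. l (A x) - l 0)"
    using linear_compose[OF assms(2), of "\<lambda>x. l x - l 0"] assms(1)
    by (simp add: affine_form_def o_def)
  then show ?thesis
    using 1 by (simp add: affine_form_def linear_0[OF assms(2)])
qed

lemma affine_form_add: "affine_form l \<Longrightarrow> affine_form m \<Longrightarrow> affine_form (\<lambda>x. l x + m x)"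
  unfolding affine_form_def by (drule (1) linear_compose_add) (simp add: algebra_simps)

lemma affine_form_diff: "affine_form l \<Longrightarrow> affine_form m \<Longrightarrow> affine_form (\<lambda>x. l x - m x)"
  unfolding affine_form_def by (drule (1) linear_compose_sub) (simp add: algebra_simps)

lemma affine_form_linear: "linear l \<Longrightarrow> affine_form l"
  by (simp add: affine_form_def linear_0)

lemmas affine_form_intros = affine_form_const affine_form_add affine_form_diff
  affine_form_linear[OF linear_fst] affine_form_linear[OF linear_snd]
  affine_form_linear[OF linear_compose[OF linear_snd linear_fst, unfolded o_def]]
  affine_form_linear[OF linear_compose[OF linear_snd linear_snd, unfolded o_def]]

text \<open>
  Polynomial functions of degree less than \<open>d\<close>, on any real vector space and without a choice of
  coordinates. The strict bound lets the zero function be the only member for \<open>d = 0\<close>, so that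
  division and differencing lower the index by one without exception.
\<close>

inductive poly_below :: "nat \<Rightarrow> ('a::real_vector \<Rightarrow> real) \<Rightarrow> bool"
  where
    zero: "poly_below d (\<lambda>x. 0)"
  | const: "poly_below (Suc d) (\<lambda>x. c)"
  | add: "poly_below d f \<Longrightarrow> poly_below d g \<Longrightarrow> poly_below d (\<lambda>x. f x + g x)"
  | mult: "affine_form l \<Longrightarrow> poly_below d f \<Longrightarrow> poly_below (Suc d) (\<lambda>x. l x * f x)"

lemma poly_below_Suc: "poly_below d f \<Longrightarrow> poly_below (Suc d) f"
  using poly_below.mult[OF affine_form_const[of 1]] by simp

lemma poly_below_mono: "poly_below d f \<Longrightarrow> d \<le> e \<Longrightarrow> poly_below e f"
  by (rotate_tac 1, induction e rule: dec_induct) (auto intro: poly_below_Suc)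

lemma poly_below_cmult: "poly_below d f \<Longrightarrow> poly_below d (\<lambda>x. c * f x)"
proof (induction rule: poly_below.induct)
  case (add d f g)
  then show ?case by (simp add: distrib_left poly_below.add)
next
  case (mult l d f)
  then show ?case using poly_below.mult[OF mult.hyps(1) mult.IH] by (simp add: mult.left_commute)
qed (auto intro: poly_below.intros)

lemma poly_below_diff:
  assumes "poly_below d f" "poly_below d g"
  shows "poly_below d (\<lambda>x. f x - g x)"
  using poly_below.add[OF assms(1) poly_below_cmult[OF assms(2), of "-1"]] by simp

lemma poly_below_compose:
  assumes "poly_below d f" "linear A"
  shows "poly_below d (\<lambda>x. f (u + A x))"
  using assms(1)
  by induction (auto intro: poly_below.intros affine_form_compose[OF _ assms(2)])

lemma poly_below_0: "poly_below 0 f \<Longrightarrow> f x = 0"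
  by (induction "0::nat" f rule: poly_below.induct) auto

lemma poly_below_1: "poly_below (Suc 0) f \<Longrightarrow> f x = f y"
proof (induction "Suc 0" f rule: poly_below.induct)
  case (add f g)
  then show ?case by metis
qed (auto simp: poly_below_0)

lemma poly_below_2: "poly_below (Suc (Suc 0)) f \<Longrightarrow> affine_form f"
proof (induction "Suc (Suc 0)" f rule: poly_below.induct)
  case (add f g)
  then show ?case by (auto simp: affine_form_def linear_iff algebra_simps)
next
  case (mult l f)
  obtain c where "f = (\<lambda>x. c)"
    using poly_below_1[OF mult.hyps(2)] by blast
  then show ?case
    using mult.hyps(1) linear_compose_scale_right[of "\<lambda>x. l x - l 0" c]
    by (auto simp: affine_form_def algebra_simps)
qed (auto simp: affine_form_const)

lemma poly_below_line:
  assumes "poly_below d f"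
  shows "\<exists>p. (p = 0 \<or> degree p < d) \<and> (\<forall>t. f (v + t *\<^sub>R w) = poly p t)"
  using assms
proof induction
  case (zero d)
  show ?case by (rule exI[of _ 0]) simp
next
  case (const d c)
  show ?case by (rule exI[of _ "[:c:]"]) simp
next
  case (add d f g)
  then obtain p q where "p = 0 \<or> degree p < d" "q = 0 \<or> degree q < d"
    "\<And>t. f (v + t *\<^sub>R w) = poly p t" "\<And>t. g (v + t *\<^sub>R w) = poly q t"
    by blast
  then show ?case
    by (intro exI[of _ "p + q"]) (auto intro: degree_add_less)
next
  case (mult l d f)
  then obtain p where p: "p = 0 \<or> degree p < d" "\<And>t. f (v + t *\<^sub>R w) = poly p t"
    by blast
  have "degree ([:l v, l w - l 0:] * p) < Suc d" if "p \<noteq> 0"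
    using degree_mult_le[of "[:l v, l w - l 0:]" p] p(1) that
    by (auto split: if_splits)
  then show ?case
    using p(2)
    by (intro exI[of _ "[:l v, l w - l 0:] * p"])
      (cases "p = 0"; auto simp: affine_form_line[OF mult.hyps(1)] algebra_simps)
qed

text \<open>
  The shift \<open>x \<mapsto> x + e\<close> changes an affine form \<open>l\<close> only by a constant. In the product rule
  \<open>\<Delta>(l f) = l \<Delta>f + (\<Delta>l) (f \<circ> shift)\<close> both terms therefore stay below the degree of \<open>l f\<close>.
\<close>

lemma poly_below_difference:
  assumes "poly_below (Suc d) f"
  shows "poly_below d (\<lambda>x. f x - f (x + e))"
proof -
  \<comment> \<open>Induction needs an arbitrary index in place of \<open>Suc d\<close>; hence the truncated \<open>d - 1\<close>.\<close>
  have "poly_below (d - 1) (\<lambda>x. f x - f (x + e))" if "poly_below d f" for d and f :: "'a \<Rightarrow> real"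
    using that
  proof induction
    case (zero d)
    show ?case by (simp add: poly_below.zero)
  next
    case (const d c)
    show ?case by (simp add: poly_below.zero)
  next
    case (add d f g)
    from poly_below.add[OF add.IH] show ?case by (simp add: algebra_simps)
  next
    case (mult l d f)
    have le: "l (x + e) = l x + (l e - l 0)" for x
      using affine_form_line[OF mult.hyps(1), of x 1 e] by simp
    have 1: "poly_below d (\<lambda>x. l x * (f x - f (x + e)))"
    proof (cases d)
      case 0
      then show ?thesis
        using poly_below_0 mult.hyps(2) by (simp add: poly_below_0 poly_below.zero)
    next
      case (Suc d')
      then show ?thesis using poly_below.mult[OF mult.hyps(1) mult.IH] by simp
    qed
    have 2: "poly_below d (\<lambda>x. (l 0 - l e) * f (x + e))"
      using poly_below_cmult[OF poly_below_compose[OF mult.hyps(2) linear_id, of e]]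
      by (simp add: add.commute)
    show ?case
      using poly_below.add[OF 1 2] by (simp add: le algebra_simps)
  qed
  from this[OF assms] show ?thesis by simp
qed

section \<open>Division by affine forms\<close>

text \<open>
  Let \<open>w\<close> be a direction along which \<open>l\<close> has slope \<open>1\<close>, so that \<open>\<pi> x = x - l x *\<^sub>R w\<close> projects
  onto the hyperplane \<open>l = 0\<close>. Every polynomial \<open>f\<close> equals \<open>f \<circ> \<pi>\<close> plus a multiple of \<open>l\<close>, which is
  division with remainder by \<open>l\<close>; if \<open>f\<close> vanishes on the hyperplane, the remainder \<open>f \<circ> \<pi>\<close> is zero.
\<close>

lemma affine_form_factor:
  assumes F: "poly_below (Suc d) F" and l: "affine_form l" "l p = 0"
    and zero: "\<And>x. l x = 0 \<Longrightarrow> F x = 0"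
  shows "\<exists>G. poly_below d G \<and> (\<forall>x. F x = l x * G x)"
proof (cases "\<forall>x. l x = 0")
  case True
  then show ?thesis
    using zero by (intro exI[of _ "\<lambda>x. 0"]) (auto intro: poly_below.zero)
next
  case False
  then obtain q where q: "l q \<noteq> 0" by blast
  define w where "w = (1 / l q) *\<^sub>R (q - p)"
  have lw: "l (x - l x *\<^sub>R w) = 0" for x
    using affine_form_affine[OF l(1), of x "- l x / l q" q p] q l(2) by (simp add: w_def)
  have lin: "linear (\<lambda>x. x - (l x - l 0) *\<^sub>R w)"
  proof -
    have "linear (\<lambda>c. c *\<^sub>R w)"
      by (simp add: linear_iff scaleR_left_distrib)
    from linear_compose[OF _ this, of "\<lambda>x. l x - l 0"] have "linear (\<lambda>x. (l x - l 0) *\<^sub>R w)"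
      using l(1) by (simp add: affine_form_def o_def)
    from linear_compose_sub[OF linear_ident this] show ?thesis .
  qed
  \<comment> \<open>The projection is an affine map, so composing with it keeps the degree.\<close>
  have pr: "x - l x *\<^sub>R w = - (l 0 *\<^sub>R w) + (x - (l x - l 0) *\<^sub>R w)" for x
    by (simp add: algebra_simps)
  have "\<exists>G. poly_below (d - 1) G \<and> (\<forall>x. f x = f (x - l x *\<^sub>R w) + l x * G x)"
    if "poly_below d f" for d and f :: "'a \<Rightarrow> real"
    using that
  proof induction
    case (zero d)
    show ?case by (rule exI[of _ "\<lambda>x. 0"]) (auto intro: poly_below.zero)
  next
    case (const d c)
    show ?case by (rule exI[of _ "\<lambda>x. 0"]) (auto intro: poly_below.zero)
  next
    case (add d f g)
    then obtain G H where GH: "poly_below (d - 1) G" "poly_below (d - 1) H"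
      and eq: "\<And>x. f x = f (x - l x *\<^sub>R w) + l x * G x" "\<And>x. g x = g (x - l x *\<^sub>R w) + l x * H x"
      by blast
    have "f x + g x = f (x - l x *\<^sub>R w) + g (x - l x *\<^sub>R w) + l x * (G x + H x)" for x
      using arg_cong2[OF eq(1)[of x] eq(2)[of x], of "(+)"] by (simp only: distrib_left ac_simps)
    with poly_below.add[OF GH] show ?case by blast
  next
    case (mult m d f)
    then obtain G where G: "poly_below (d - 1) G"
      and eq: "\<And>x. f x = f (x - l x *\<^sub>R w) + l x * G x"
      by blast
    define c where "c = m w - m 0"
    have m: "m (x - l x *\<^sub>R w) = m x - l x * c" for x
      using affine_form_line[OF mult.hyps(1), of x "- l x" w] by (simp add: c_def)
    have 1: "poly_below d (\<lambda>x. m x * G x)"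
    proof (cases d)
      case 0
      then show ?thesis using poly_below_0 G by (simp add: poly_below_0 poly_below.zero)
    next
      case (Suc d')
      then show ?thesis using poly_below.mult[OF mult.hyps(1) G] by simp
    qed
    have 2: "poly_below d (\<lambda>x. c * f (x - l x *\<^sub>R w))"
      unfolding pr by (rule poly_below_cmult[OF poly_below_compose[OF mult.hyps(2) lin]])
    have "m x * f x = m (x - l x *\<^sub>R w) * f (x - l x *\<^sub>R w)
        + l x * (m x * G x + c * f (x - l x *\<^sub>R w))" for x
    proof -
      have "m x * f x = m x * (f (x - l x *\<^sub>R w) + l x * G x)"
        using eq[of x] by (rule arg_cong)
      then show ?thesis
        unfolding m by (simp only: ring_distribs ac_simps)
    qed
    with poly_below.add[OF 1 2] show ?case
      unfolding diff_Suc_1 by blast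
  qed
  from this[OF F] obtain G where G: "poly_below d G"
    and eq: "\<And>x. F x = F (x - l x *\<^sub>R w) + l x * G x"
    unfolding diff_Suc_1 by blast
  have "F x = l x * G x" for x
    using eq[of x] zero[OF lw[of x]] by linarith
  with G show ?thesis by blast
qed

text \<open>
  Each form comes with a point \<open>p\<close> of its hyperplane that avoids the hyperplanes of all earlier
  forms. After division by \<open>l\<close>, the quotient is known to vanish on a later hyperplane only where
  \<open>l \<noteq> 0\<close>; along a line towards \<open>p\<close> inside the later hyperplane \<open>l\<close> is not identically zero, so the
  quotient, being a polynomial on this line, vanishes there too.
\<close>

lemma affine_forms_factor:
  assumes "poly_below (d + length ls) F"
    and "\<forall>(l, p) \<in> set ls. affine_form l \<and> l p = 0 \<and> (\<forall>x. l x = 0 \<longrightarrow> F x = 0)"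
    and "sorted_wrt (\<lambda>(l, _) (_, p). l p \<noteq> 0) ls"
  shows "\<exists>G. poly_below d G \<and> (\<forall>x. F x = (\<Prod>(l, p)\<leftarrow>ls. l x) * G x)"
  using assms
proof (induction ls arbitrary: F)
  case Nil
  then show ?case by auto
next
  case (Cons a ls)
  obtain l p where a: "a = (l, p)" by force
  have l: "affine_form l" "l p = 0" "\<And>x. l x = 0 \<Longrightarrow> F x = 0"
    using Cons.prems(2) by (auto simp: a)
  obtain G where G: "poly_below (d + length ls) G" "\<And>x. F x = l x * G x"
    using affine_form_factor[of "d + length ls" F, OF _ l] Cons.prems(1) by auto
  have "\<exists>H. poly_below d H \<and> (\<forall>x. G x = (\<Prod>(l, p)\<leftarrow>ls. l x) * H x)"
  proof (rule Cons.IH[OF G(1)], safe)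
    fix l' p'
    assume "(l', p') \<in> set ls"
    then have l': "affine_form l'" "l' p' = 0" "\<And>x. l' x = 0 \<Longrightarrow> F x = 0" "l p' \<noteq> 0"
      using Cons.prems(2,3) by (auto simp: a)
    show "affine_form l'" "l' p' = 0"
      using l' by auto
    show "G x = 0" if x: "l' x = 0" for x
    proof -
      obtain r where r: "\<And>t. G (x + t *\<^sub>R (p' - x)) = poly r t"
        using poly_below_line[OF G(1)] by blast
      have "poly ([:l x, l p' - l x:] * r) t = 0" for t
      proof -
        have "l' (x + t *\<^sub>R (p' - x)) = 0"
          using affine_form_affine[OF l'(1), of x t p' x] x l'(2) by simp
        then have "l (x + t *\<^sub>R (p' - x)) * poly r t = 0"
          using l'(3) G(2) r by metis
        moreover have "poly ([:l x, l p' - l x:] * r) t = l (x + t *\<^sub>R (p' - x)) * poly r t"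
          unfolding affine_form_affine[OF l(1)] by (simp add: algebra_simps)
        ultimately show ?thesis by simp
      qed
      then have "[:l x, l p' - l x:] * r = 0"
        using poly_all_0_iff_0 by blast
      moreover have "[:l x, l p' - l x:] \<noteq> 0"
        using l'(4) by auto
      ultimately have "r = 0"
        by (metis mult_eq_0_iff)
      then show ?thesis
        using r[of 0] by simp
    qed
  next
    show "sorted_wrt (\<lambda>(l, _) (_, p). l p \<noteq> 0) ls"
      using Cons.prems(3) by simp
  qed
  then show ?case
    using G(2) by (auto simp: a mult.assoc)
qed

section \<open>Order of vanishing\<close>

text \<open>
  For a polynomial \<open>f\<close> this says that all derivatives of order less than \<open>k\<close> are zero at \<open>v\<close>. Testing
  along lines reduces every use to univariate polynomials.
\<close>

definition vanishes :: "nat \<Rightarrow> 'a::real_vector \<Rightarrow> ('a \<Rightarrow> real) \<Rightarrow> bool"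
  where "vanishes k v f \<longleftrightarrow> (\<forall>w. \<exists>p. \<forall>t. f (v + t *\<^sub>R w) = t ^ k * poly p t)"

lemma vanishes_mono:
  assumes "vanishes k v f" "j \<le> k"
  shows "vanishes j v f"
  unfolding vanishes_def
proof
  fix w
  obtain p where p: "\<And>t. f (v + t *\<^sub>R w) = t ^ k * poly p t"
    using assms(1) unfolding vanishes_def by blast
  show "\<exists>p. \<forall>t. f (v + t *\<^sub>R w) = t ^ j * poly p t"
    using p assms(2)
    by (intro exI[of _ "monom 1 (k - j) * p"])
      (simp add: poly_monom mult.assoc[symmetric] power_add[symmetric])
qed

lemma vanishes_eq_0:
  assumes "vanishes k v f" "k > 0"
  shows "f v = 0"
proof -
  obtain p where "\<And>t. f (v + t *\<^sub>R 0) = t ^ k * poly p t"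
    using assms(1) unfolding vanishes_def by blast
  from this[of 0] show ?thesis using assms(2) by simp
qed

lemma vanishes_diff:
  assumes "vanishes k v f" "vanishes k v g"
  shows "vanishes k v (\<lambda>x. f x - g x)"
  unfolding vanishes_def
proof
  fix w
  obtain p q where "\<And>t. f (v + t *\<^sub>R w) = t ^ k * poly p t" "\<And>t. g (v + t *\<^sub>R w) = t ^ k * poly q t"
    using assms unfolding vanishes_def by blast
  then show "\<exists>p. \<forall>t. f (v + t *\<^sub>R w) - g (v + t *\<^sub>R w) = t ^ k * poly p t"
    by (intro exI[of _ "p - q"]) (simp add: right_diff_distrib)
qed

lemma vanishes_compose:
  assumes "vanishes k (u + A v) f" "linear A"
  shows "vanishes k v (\<lambda>x. f (u + A x))"
  using assms(1) unfolding vanishes_def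
  by (simp add: linear_add[OF assms(2)] linear_cmul[OF assms(2)] add.assoc[symmetric])

lemma vanishes_mult_form:
  assumes "affine_form l" "vanishes k v f"
  shows "vanishes (if l v = 0 then Suc k else k) v (\<lambda>x. l x * f x)"
  unfolding vanishes_def
proof
  fix w
  obtain p where p: "\<And>t. f (v + t *\<^sub>R w) = t ^ k * poly p t"
    using assms(2) unfolding vanishes_def by blast
  show "\<exists>p. \<forall>t. l (v + t *\<^sub>R w) * f (v + t *\<^sub>R w) = t ^ (if l v = 0 then Suc k else k) * poly p t"
    by (intro exI[of _ "(if l v = 0 then [:l w - l 0:] else [:l v, l w - l 0:]) * p"])
      (simp add: p affine_form_line[OF assms(1)] algebra_simps)
qed

text \<open>
  On the line through \<open>u\<close> and \<open>v\<close> the polynomial is divisible by \<open>t ^ k * (t - 1) ^ k\<close>, whose degree is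
  at least \<open>d\<close>.
\<close>

lemma vanishes_two_points:
  assumes F: "poly_below d F" and "vanishes k u F" "vanishes k v F" and d: "d \<le> 2 * k"
  shows "F (u + t *\<^sub>R (v - u)) = 0"
proof -
  obtain r where r: "r = 0 \<or> degree r < d" "\<And>t. F (u + t *\<^sub>R (v - u)) = poly r t"
    using poly_below_line[OF F] by blast
  obtain p where p: "\<And>t. F (u + t *\<^sub>R (v - u)) = t ^ k * poly p t"
    using assms(2) unfolding vanishes_def by blast
  obtain q where q: "\<And>t. F (v + t *\<^sub>R (v - u)) = t ^ k * poly q t"
    using assms(3) unfolding vanishes_def by blast
  have "poly r t = poly ([:0, 1:] ^ k * p) t" for t
    using r(2)[of t] p[of t] by simp
  then have 1: "[:0, 1:] ^ k dvd r"
    by (metis dvd_triv_left poly_ext)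
  have "poly r t = poly ([:-1, 1:] ^ k * (q \<circ>\<^sub>p [:-1, 1:])) t" for t
    using r(2)[of t] q[of "t - 1"] by (simp add: poly_pcompose algebra_simps)
  then have 2: "[:-1, 1:] ^ k dvd r"
    by (metis dvd_triv_left poly_ext)
  have "r = 0"
  proof (rule ccontr)
    assume "r \<noteq> 0"
    obtain s where s: "r = [:0, 1:] ^ k * s"
      using 1 by blast
    then have "s \<noteq> 0" using \<open>r \<noteq> 0\<close> by auto
    have "order 1 ([:0, 1:] ^ k :: real poly) = 0"
      by (rule order_0I) simp
    then have "order 1 r = order 1 s"
      using s \<open>r \<noteq> 0\<close> by (simp add: order_mult)
    moreover have "k \<le> order 1 r"
      using 2 \<open>r \<noteq> 0\<close> by (simp add: order_divides)
    moreover have "order 1 s \<le> degree s"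
      using \<open>s \<noteq> 0\<close> by (rule order_degree)
    moreover have "degree r = k + degree s"
      using s \<open>s \<noteq> 0\<close> by (simp add: degree_mult_eq degree_power_eq)
    ultimately show False
      using r(1) \<open>r \<noteq> 0\<close> d by simp
  qed
  then show ?thesis using r(2) by simp
qed

text \<open>
  If \<open>Q\<close> vanishes to order exactly \<open>m\<close> at \<open>v\<close> along some line, and \<open>Q * L\<close> to a higher order, then
  \<open>L\<close> must vanish at \<open>v\<close>. One direction \<open>w\<close> suffices, which may be chosen outside all
  hyperplanes whose equations divide \<open>Q\<close>.
\<close>

lemma vanishes_cofactor:
  assumes F: "vanishes (Suc m) v F" "\<And>x. F x = Q x * L x" and L: "poly_below d L"
    and Q: "\<And>t. Q (v + t *\<^sub>R w) = t ^ m * q t" "isCont q 0" "q 0 \<noteq> 0"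
  shows "L v = 0"
proof -
  obtain p where p: "\<And>t. F (v + t *\<^sub>R w) = t ^ Suc m * poly p t"
    using F(1) unfolding vanishes_def by blast
  obtain r where r: "\<And>t. L (v + t *\<^sub>R w) = poly r t"
    using poly_below_line[OF L] by blast
  have eq: "q t * poly r t = t * poly p t" if "t \<noteq> 0" for t
  proof -
    have "t ^ m * (q t * poly r t) = t ^ m * (t * poly p t)"
      using p[of t] F(2)[of "v + t *\<^sub>R w"] Q(1)[of t] r[of t] by (simp add: mult_ac)
    then show ?thesis using that by simp
  qed
  have "(\<lambda>t. q t * poly r t) \<midarrow>0\<rightarrow> q 0 * poly r 0"
    using Q(2) by (intro tendsto_intros) (auto simp: isCont_def[symmetric])
  moreover have "(\<lambda>t. t * poly p t) \<midarrow>0\<rightarrow> 0 * poly p 0"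
    by (intro tendsto_intros)
  then have "(\<lambda>t. q t * poly r t) \<midarrow>0\<rightarrow> 0"
    by (subst LIM_equal[where g = "\<lambda>t. t * poly p t"]) (auto simp: eq)
  ultimately have "q 0 * poly r 0 = 0"
    by (rule LIM_unique)
  then show ?thesis using Q(3) r[of 0] by simp
qed

section \<open>Polynomials vanishing to high order on small cubes\<close>

text \<open>
  Each of the three points lies on two of the three lines through pairs of them, so the cofactor
  of the three line equations still vanishes there to order one. The direction \<open>(1, 1)\<close> is parallel to
  none of the lines.
\<close>

lemma vanishes_triangle:
  fixes F :: "real \<times> real \<Rightarrow> real"
  assumes F: "poly_below 5 F"
    and v: "vanishes 3 (1, 0) F" "vanishes 3 (0, 1) F" "vanishes 3 (1, 1) F"
  shows "F 0 = 0"
proof -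
  define ls :: "((real \<times> real \<Rightarrow> real) \<times> real \<times> real) list" where
    "ls = [(\<lambda>p. fst p - 1, (1, 2)), (\<lambda>p. snd p - 1, (2, 1)), (\<lambda>p. fst p + snd p - 1, (2, -1))]"
  have lines: "F (1, t) = 0" "F (t, 1) = 0" "F (t, 1 - t) = 0" for t
    using vanishes_two_points[OF F v(1,3), of t] vanishes_two_points[OF F v(2,3), of t]
      vanishes_two_points[OF F v(2,1), of t] by simp_all
  have zero: "F x = 0" if "fst x = 1 \<or> snd x = 1 \<or> fst x + snd x = 1" for x
  proof -
    have "x = (1, snd x) \<or> x = (fst x, 1) \<or> x = (fst x, 1 - fst x)"
      using that by (auto simp: prod_eq_iff)
    then show ?thesis using lines by metis
  qed
  have "\<exists>L. poly_below 2 L \<and> (\<forall>x. F x = (\<Prod>(l, p)\<leftarrow>ls. l x) * L x)"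
  proof (rule affine_forms_factor)
    show "poly_below (2 + length ls) F" using F by (simp add: ls_def)
    show "sorted_wrt (\<lambda>(l, _) (_, p). l p \<noteq> 0) ls" by (simp add: ls_def)
    show "\<forall>(l, p) \<in> set ls. affine_form l \<and> l p = 0 \<and> (\<forall>x. l x = 0 \<longrightarrow> F x = 0)"
      unfolding ls_def using zero by (auto simp: affine_form_intros)
  qed
  then obtain L where L: "poly_below 2 L" and
    FL: "\<And>x. F x = ((fst x - 1) * (snd x - 1) * (fst x + snd x - 1)) * L x"
    by (auto simp: ls_def mult.assoc)
  have v': "vanishes (Suc 2) (1, 0) F" "vanishes (Suc 2) (0, 1) F" "vanishes (Suc 2) (1, 1) F"
    using v by (simp_all add: numeral_3_eq_3)
  have "L (1, 0) = 0"
    by (rule vanishes_cofactor[where w = "(1, 1)" and q = "\<lambda>t. (t - 1) * 2", OF v'(1) FL L])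
      (auto simp: power2_eq_square)
  moreover have "L (0, 1) = 0"
    by (rule vanishes_cofactor[where w = "(1, 1)" and q = "\<lambda>t. (t - 1) * 2", OF v'(2) FL L])
      (auto simp: power2_eq_square)
  moreover have "L (1, 1) = 0"
    by (rule vanishes_cofactor[where w = "(1, 1)" and q = "\<lambda>t. 2 * t + 1", OF v'(3) FL L])
      (auto simp: power2_eq_square)
  moreover have "affine_form L"
    using poly_below_2 L by (simp add: numeral_2_eq_2)
  \<comment> \<open>This affine combination of the three points is the origin.\<close>
  then have "L (((1, 1) + 1 *\<^sub>R ((1, 0) - (1, 1))) + 1 *\<^sub>R ((0, 1) - (1, 1)))
      = (L (1, 1) + 1 * (L (1, 0) - L (1, 1))) + 1 * (L (0, 1) - L (1, 1))"
    by (simp only: affine_form_affine)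
  ultimately have "L 0 = 0"
    by (simp add: zero_prod_def)
  then show ?thesis using FL by simp
qed

text \<open>
  Six lines join pairs of the four corners, and three of them meet at each corner. As
  the order four is one more than that, the affine cofactor vanishes at the corners. The
  direction \<open>(1, 2)\<close> is parallel to none of the six lines.
\<close>

lemma vanishes_square:
  fixes F :: "real \<times> real \<Rightarrow> real"
  assumes F: "poly_below 8 F"
    and v: "vanishes 4 (0, 0) F" "vanishes 4 (1, 0) F" "vanishes 4 (0, 1) F" "vanishes 4 (1, 1) F"
  shows "F x = 0"
proof -
  define ls :: "((real \<times> real \<Rightarrow> real) \<times> real \<times> real) list" where
    "ls = [(\<lambda>p. fst p, (0, 5)), (\<lambda>p. fst p - 1, (1, 5)), (\<lambda>p. snd p, (5, 0)), (\<lambda>p. snd p - 1, (5, 1)),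
      (\<lambda>p. fst p - snd p, (7, 7)), (\<lambda>p. fst p + snd p - 1, (3, -2))]"
  have lines: "F (0, t) = 0" "F (1, t) = 0" "F (t, 0) = 0" "F (t, 1) = 0" "F (t, t) = 0"
    "F (t, 1 - t) = 0" for t
    using vanishes_two_points[OF F v(1,3), of t] vanishes_two_points[OF F v(2,4), of t]
      vanishes_two_points[OF F v(1,2), of t] vanishes_two_points[OF F v(3,4), of t]
      vanishes_two_points[OF F v(1,4), of t] vanishes_two_points[OF F v(3,2), of t] by simp_all
  have zero: "F x = 0" if "fst x = 0 \<or> fst x = 1 \<or> snd x = 0 \<or> snd x = 1 \<or> fst x = snd x
      \<or> fst x + snd x = 1" for x
  proof -
    have "x = (0, snd x) \<or> x = (1, snd x) \<or> x = (fst x, 0) \<or> x = (fst x, 1) \<or> x = (fst x, fst x)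
        \<or> x = (fst x, 1 - fst x)"
      using that by (auto simp: prod_eq_iff)
    then show ?thesis using lines by metis
  qed
  have "\<exists>L. poly_below 2 L \<and> (\<forall>x. F x = (\<Prod>(l, p)\<leftarrow>ls. l x) * L x)"
  proof (rule affine_forms_factor)
    show "poly_below (2 + length ls) F" using F by (simp add: ls_def)
    show "sorted_wrt (\<lambda>(l, _) (_, p). l p \<noteq> 0) ls" by (simp add: ls_def)
    show "\<forall>(l, p) \<in> set ls. affine_form l \<and> l p = 0 \<and> (\<forall>x. l x = 0 \<longrightarrow> F x = 0)"
      unfolding ls_def using zero by (auto simp: affine_form_intros)
  qed
  then obtain L where L: "poly_below 2 L" and
    FL: "\<And>x. F x = (fst x * (fst x - 1) * snd x * (snd x - 1) * (fst x - snd x)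
      * (fst x + snd x - 1)) * L x"
    by (auto simp: ls_def mult.assoc)
  have v': "vanishes (Suc 3) (0, 0) F" "vanishes (Suc 3) (1, 0) F" "vanishes (Suc 3) (0, 1) F"
    using v by simp_all
  have "L (0, 0) = 0"
    by (rule vanishes_cofactor[where w = "(1, 2)" and q = "\<lambda>t. -2 * (t - 1) * (2 * t - 1) * (3 * t - 1)",
          OF v'(1) FL L]) (auto simp: power3_eq_cube algebra_simps)
  moreover have "L (1, 0) = 0"
    by (rule vanishes_cofactor[where w = "(1, 2)" and q = "\<lambda>t. 6 * (t + 1) * (2 * t - 1) * (1 - t)",
          OF v'(2) FL L]) (auto simp: power3_eq_cube algebra_simps)
  moreover have "L (0, 1) = 0"
    by (rule vanishes_cofactor[where w = "(1, 2)" and q = "\<lambda>t. 6 * (t - 1) * (2 * t + 1) * (- 1 - t)",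
          OF v'(3) FL L]) (auto simp: power3_eq_cube algebra_simps)
  moreover have "affine_form L"
    using poly_below_2 L by (simp add: numeral_2_eq_2)
  then have "L (((0, 0) + a *\<^sub>R ((1, 0) - (0, 0))) + b *\<^sub>R ((0, 1) - (0, 0)))
      = (L (0, 0) + a * (L (1, 0) - L (0, 0))) + b * (L (0, 1) - L (0, 0))" for a b
    by (simp only: affine_form_affine)
  ultimately have "L (a, b) = 0" for a b
    by simp
  from this[of "fst x" "snd x"] have "L x = 0"
    by simp
  then show ?thesis using FL by simp
qed

lemma vanishes_parallelogram:
  assumes F: "poly_below 8 F" and
    "vanishes 4 a F" "vanishes 4 (a + p) F" "vanishes 4 (a + q) F" "vanishes 4 (a + p + q) F"
  shows "F (a + s *\<^sub>R p + t *\<^sub>R q) = 0"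
proof -
  define A where "A = (\<lambda>z :: real \<times> real. fst z *\<^sub>R p + snd z *\<^sub>R q)"
  have A: "linear A"
    by (simp add: A_def linear_iff scaleR_left_distrib scaleR_right_distrib)
  have vals: "A (0, 0) = 0" "A (1, 0) = p" "A (0, 1) = q" "A (1, 1) = p + q"
    by (simp_all add: A_def)
  have "F (a + A (s, t)) = 0"
    by (rule vanishes_square[OF poly_below_compose[OF F A]];
        rule vanishes_compose[OF _ A]) (use assms in \<open>simp_all add: vals add.assoc\<close>)
  then show ?thesis by (simp add: A_def add.assoc)
qed

text \<open>
  The four nonzero vertices on each of the planes \<open>x\<^sub>i = 1\<close> and \<open>x\<^sub>i + x\<^sub>j = 1\<close> form a
  parallelogram. The direction \<open>(1, 2, 4)\<close> is parallel to none of these six planes.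
\<close>

lemma vanishes_3cube:
  fixes F :: "real \<times> real \<times> real \<Rightarrow> real"
  assumes F: "poly_below 8 F"
    and v: "vanishes 4 (1, 0, 0) F" "vanishes 4 (0, 1, 0) F" "vanishes 4 (0, 0, 1) F"
      "vanishes 4 (1, 1, 0) F" "vanishes 4 (1, 0, 1) F" "vanishes 4 (0, 1, 1) F"
      "vanishes 4 (1, 1, 1) F"
  shows "F 0 = 0"
proof -
  define ls :: "((real \<times> real \<times> real \<Rightarrow> real) \<times> real \<times> real \<times> real) list" where
    "ls = [(\<lambda>p. fst p - 1, (1, 5, 7)), (\<lambda>p. fst (snd p) - 1, (5, 1, 7)), (\<lambda>p. snd (snd p) - 1, (5, 7, 1)),
      (\<lambda>p. fst p + fst (snd p) - 1, (3, -2, 9)), (\<lambda>p. fst (snd p) + snd (snd p) - 1, (9, 3, -2)),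
      (\<lambda>p. fst p + snd (snd p) - 1, (3, 9, -2))]"
  note planes = vanishes_parallelogram[OF F]
  have planes: "F (1, s, t) = 0" "F (s, 1, t) = 0" "F (s, t, 1) = 0"
    "F (s, 1 - s, t) = 0" "F (t, s, 1 - s) = 0" "F (s, t, 1 - s) = 0" for s t
    using planes[of "(1, 0, 0)" "(0, 1, 0)" "(0, 0, 1)" s t] planes[of "(0, 1, 0)" "(1, 0, 0)" "(0, 0, 1)" s t]
      planes[of "(0, 0, 1)" "(1, 0, 0)" "(0, 1, 0)" s t] planes[of "(0, 1, 0)" "(1, -1, 0)" "(0, 0, 1)" s t]
      planes[of "(0, 0, 1)" "(0, 1, -1)" "(1, 0, 0)" s t] planes[of "(0, 0, 1)" "(1, 0, -1)" "(0, 1, 0)" s t]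
      v by simp_all
  have zero: "F x = 0" if "fst x = 1 \<or> fst (snd x) = 1 \<or> snd (snd x) = 1 \<or> fst x + fst (snd x) = 1
      \<or> fst (snd x) + snd (snd x) = 1 \<or> fst x + snd (snd x) = 1" for x
  proof -
    obtain a b c where x: "x = (a, b, c)" by (metis prod.collapse)
    then have "x = (1, b, c) \<or> x = (a, 1, c) \<or> x = (a, b, 1) \<or> x = (a, 1 - a, c)
        \<or> x = (a, b, 1 - b) \<or> x = (a, b, 1 - a)"
      using that by auto
    then show ?thesis using planes by metis
  qed
  have "\<exists>L. poly_below 2 L \<and> (\<forall>x. F x = (\<Prod>(l, p)\<leftarrow>ls. l x) * L x)"
  proof (rule affine_forms_factor)
    show "poly_below (2 + length ls) F" using F by (simp add: ls_def)
    show "sorted_wrt (\<lambda>(l, _) (_, p). l p \<noteq> 0) ls" by (simp add: ls_def)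
    show "\<forall>(l, p) \<in> set ls. affine_form l \<and> l p = 0 \<and> (\<forall>x. l x = 0 \<longrightarrow> F x = 0)"
      unfolding ls_def using zero by (auto simp: affine_form_intros)
  qed
  then obtain L where L: "poly_below 2 L" and
    FL: "\<And>x. F x = ((fst x - 1) * (fst (snd x) - 1) * (snd (snd x) - 1) * (fst x + fst (snd x) - 1)
      * (fst (snd x) + snd (snd x) - 1) * (fst x + snd (snd x) - 1)) * L x"
    by (auto simp: ls_def mult.assoc)
  have v': "vanishes (Suc 3) (1, 0, 0) F" "vanishes (Suc 3) (0, 1, 0) F"
    "vanishes (Suc 3) (0, 0, 1) F" "vanishes (Suc 3) (1, 1, 1) F"
    using v by simp_all
  have "L (1, 0, 0) = 0"
    by (rule vanishes_cofactor[where w = "(1, 2, 4)"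
          and q = "\<lambda>t. 15 * (2 * t - 1) * (4 * t - 1) * (6 * t - 1)", OF v'(1) FL L])
      (auto simp: power3_eq_cube algebra_simps)
  moreover have "L (0, 1, 0) = 0"
    by (rule vanishes_cofactor[where w = "(1, 2, 4)"
          and q = "\<lambda>t. 36 * (t - 1) * (4 * t - 1) * (5 * t - 1)", OF v'(2) FL L])
      (auto simp: power3_eq_cube algebra_simps)
  moreover have "L (0, 0, 1) = 0"
    by (rule vanishes_cofactor[where w = "(1, 2, 4)"
          and q = "\<lambda>t. 120 * (t - 1) * (2 * t - 1) * (3 * t - 1)", OF v'(3) FL L])
      (auto simp: power3_eq_cube algebra_simps)
  moreover have "L (1, 1, 1) = 0"
    by (rule vanishes_cofactor[where w = "(1, 2, 4)"
          and q = "\<lambda>t. 8 * (3 * t + 1) * (6 * t + 1) * (5 * t + 1)", OF v'(4) FL L])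
      (auto simp: power3_eq_cube algebra_simps)
  moreover have "affine_form L"
    using poly_below_2 L by (simp add: numeral_2_eq_2)
  \<comment> \<open>This affine combination of the four points is the origin.\<close>
  then have "L ((((1, 0, 0) + (1/2) *\<^sub>R ((1, 1, 1) - (1, 0, 0))) + (1/2) *\<^sub>R ((0, 1, 0) - (1, 1, 1)))
        + (1/2) *\<^sub>R ((0, 0, 1) - (1, 1, 1)))
      = ((L (1, 0, 0) + (1/2) * (L (1, 1, 1) - L (1, 0, 0))) + (1/2) * (L (0, 1, 0) - L (1, 1, 1)))
        + (1/2) * (L (0, 0, 1) - L (1, 1, 1))"
    by (simp only: affine_form_affine)
  ultimately have "L 0 = 0"
    by (simp add: zero_prod_def)
  then show ?thesis using FL by simp
qed

section \<open>Lower bounds for almost covers\<close>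

text \<open>
  The coordinates in \<open>S\<close> are removed one at a time by differencing in direction \<open>axis i 1\<close>. The
  value at \<open>0\<close> does not change, since \<open>axis i 1\<close> is a nonzero vertex and hence a zero of \<open>F\<close>.
\<close>

lemma difference_out_coordinates:
  fixes F :: "real^'n \<Rightarrow> real"
  assumes "finite S" "S \<inter> T = {}" "poly_below (d + card S) F" "k > 0"
    and "\<And>v. v \<in> cube \<Longrightarrow> v \<noteq> 0 \<Longrightarrow> (\<forall>i. i \<notin> S \<union> T \<longrightarrow> v $ i = 0) \<Longrightarrow> vanishes k v F"
  shows "\<exists>G. poly_below d G \<and> G 0 = F 0 \<and>
    (\<forall>v. v \<in> cube \<longrightarrow> v \<noteq> 0 \<longrightarrow> (\<forall>i. i \<notin> T \<longrightarrow> v $ i = 0) \<longrightarrow> vanishes k v G)"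
  using assms
proof (induction S arbitrary: F rule: finite_induct)
  case empty
  then show ?case by auto
next
  case (insert i S)
  define e :: "real^'n" where "e = axis i 1"
  define F' where "F' = (\<lambda>x. F x - F (x + e))"
  have ei: "e $ j = (if j = i then 1 else 0)" for j
    by (simp add: e_def axis_def)
  have "F e = 0"
    using \<open>k > 0\<close> ei
    by (intro vanishes_eq_0[of k] insert.prems(4)) (auto simp: cube_def vec_eq_iff)
  then have F'0: "F' 0 = F 0"
    by (simp add: F'_def)
  have "\<exists>G. poly_below d G \<and> G 0 = F' 0 \<and>
    (\<forall>v. v \<in> cube \<longrightarrow> v \<noteq> 0 \<longrightarrow> (\<forall>i. i \<notin> T \<longrightarrow> v $ i = 0) \<longrightarrow> vanishes k v G)"
  proof (rule insert.IH)
    show "S \<inter> T = {}" using insert.prems by auto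
    show "poly_below (d + card S) F'"
      unfolding F'_def using insert.prems(2) insert.hyps
      by (intro poly_below_difference) simp
    show "k > 0" by fact
    fix v :: "real^'n"
    assume v: "v \<in> cube" "v \<noteq> 0" "\<forall>j. j \<notin> S \<union> T \<longrightarrow> v $ j = 0"
    then have vi: "v $ i = 0"
      using insert.hyps insert.prems(1) by auto
    have "vanishes k v F"
      using v by (intro insert.prems(4)) auto
    moreover have "vanishes k (v + e) F"
    proof (rule insert.prems(4))
      show "v + e \<in> cube" using v(1) vi by (auto simp: cube_def ei)
      show "v + e \<noteq> 0" using vi by (auto simp: vec_eq_iff ei)
      show "\<forall>j. j \<notin> insert i S \<union> T \<longrightarrow> (v + e) $ j = 0"
        using v(3) by (auto simp: ei)
    qed
    then have "vanishes k v (\<lambda>x. F (x + e))"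
      using vanishes_compose[of k e "\<lambda>x. x" v F] by (simp add: linear_ident add.commute)
    ultimately show "vanishes k v F'"
      unfolding F'_def by (rule vanishes_diff)
  qed
  then show ?case by (simp add: F'0)
qed

lemma hyperplanes_polynomial:
  fixes M :: "(real^'n) set multiset"
  assumes "\<forall>H \<in># M. affine_hyperplane H"
  shows "\<exists>P. poly_below (Suc (size M)) P \<and> (\<forall>v. vanishes (size {# H \<in># M. v \<in> H #}) v P) \<and>
    (\<forall>v. P v = 0 \<longleftrightarrow> (\<exists>H \<in># M. v \<in> H))"
  using assms
proof (induction M)
  case empty
  show ?case
    by (intro exI[of _ "\<lambda>x. 1"])
      (auto simp: vanishes_def poly_below.const intro: exI[of _ "1 :: real poly"])
next
  case (add H M)
  then obtain P where P: "poly_below (Suc (size M)) P"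
    "\<And>v. vanishes (size {# H \<in># M. v \<in> H #}) v P" "\<And>v. P v = 0 \<longleftrightarrow> (\<exists>H \<in># M. v \<in> H)"
    by auto
  obtain a b where H: "H = {x. a \<bullet> x = b}"
    using add.prems by (auto simp: affine_hyperplane_def)
  define l where "l = (\<lambda>x. a \<bullet> x - b)"
  have l: "affine_form l" "\<And>x. l x = 0 \<longleftrightarrow> x \<in> H"
    by (auto simp: l_def H affine_form_def linear_iff inner_add_right)
  have "vanishes (size {# K \<in># add_mset H M. v \<in> K #}) v (\<lambda>x. l x * P x)" for v
    using vanishes_mult_form[OF l(1) P(2)[of v]] by (auto simp: l(2) split: if_splits)
  moreover have "l v * P v = 0 \<longleftrightarrow> (\<exists>K \<in># add_mset H M. v \<in> K)" for v
    by (simp add: l(2) P(3))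
  moreover have "poly_below (Suc (size (add_mset H M))) (\<lambda>x. l x * P x)"
    using poly_below.mult[OF l(1) P(1)] by simp
  ultimately show ?case by blast
qed

text \<open>
  The product of the hyperplane equations, differenced in all coordinates outside \<open>T\<close>, is a
  polynomial that matters only on the face of the cube spanned by \<open>T\<close>.
\<close>

lemma almost_cover_subcube_polynomial:
  fixes M :: "(real^'n) set multiset" and T :: "'n set"
  assumes M: "almost_cover k M" and "k > 0" and size: "size M < d + (CARD('n) - card T)"
  shows "\<exists>G. poly_below d G \<and> G 0 \<noteq> 0 \<and>
    (\<forall>v. v \<in> cube \<longrightarrow> v \<noteq> 0 \<longrightarrow> (\<forall>i. i \<notin> T \<longrightarrow> v $ i = 0) \<longrightarrow> vanishes k v G)"
proof -
  obtain P where P: "poly_below (Suc (size M)) P"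
    "\<And>v. vanishes (size {# H \<in># M. v \<in> H #}) v P" "\<And>v. P v = 0 \<longleftrightarrow> (\<exists>H \<in># M. v \<in> H)"
    using hyperplanes_polynomial[of M] M unfolding almost_cover_def by blast
  have "P 0 \<noteq> 0"
    using M P(3) unfolding almost_cover_def by blast
  moreover have "\<exists>G. poly_below d G \<and> G 0 = P 0 \<and>
    (\<forall>v. v \<in> cube \<longrightarrow> v \<noteq> 0 \<longrightarrow> (\<forall>i. i \<notin> T \<longrightarrow> v $ i = 0) \<longrightarrow> vanishes k v G)"
  proof (rule difference_out_coordinates[of "- T"])
    show "poly_below (d + card (- T)) P"
      using P(1) size
      by (auto simp: Compl_eq_Diff_UNIV card_Diff_subset intro: poly_below_mono)
    fix v :: "real^'n"
    assume "v \<in> cube" "v \<noteq> 0"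
    then have "k \<le> size {# H \<in># M. v \<in> H #}"
      using M unfolding almost_cover_def by blast
    then show "vanishes k v P"
      using P(2) vanishes_mono by blast
  qed (use \<open>k > 0\<close> in auto)
  ultimately show ?thesis by auto
qed

lemma almost_3_cover_size:
  fixes M :: "(real^'n) set multiset"
  assumes M: "almost_cover 3 M" and n: "CARD('n) \<ge> 2"
  shows "CARD('n) + 3 \<le> size M"
proof (rule ccontr)
  assume small: "\<not> CARD('n) + 3 \<le> size M"
  obtain T :: "'n set" where T: "card T = 2"
    using obtain_subset_with_card_n[OF n] by blast
  then obtain i j where ij: "T = {i, j}" "i \<noteq> j"
    by (auto simp: card_2_iff)
  obtain G where G: "poly_below 5 G" "G 0 \<noteq> 0"
    "\<And>v. v \<in> cube \<Longrightarrow> v \<noteq> 0 \<Longrightarrow> (\<forall>i. i \<notin> T \<longrightarrow> v $ i = 0) \<Longrightarrow> vanishes 3 v G"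
    using almost_cover_subcube_polynomial[OF M, of 5 T] small n T by auto
  define A :: "real \<times> real \<Rightarrow> real^'n" where "A = (\<lambda>z. fst z *\<^sub>R axis i 1 + snd z *\<^sub>R axis j 1)"
  have A: "linear A"
    by (simp add: A_def linear_iff scaleR_left_distrib scaleR_right_distrib)
  have comp: "A z $ m = (if m = i then fst z else if m = j then snd z else 0)" for z m
    using ij(2) by (simp add: A_def axis_def)
  have van: "vanishes 3 (a, b) (\<lambda>z. G (0 + A z))" if "a \<in> {0, 1}" "b \<in> {0, 1}" "(a, b) \<noteq> 0" for a b
    using that ij by (intro vanishes_compose[OF _ A] G(3)) (auto simp: cube_def comp vec_eq_iff zero_prod_def)
  have "G (0 + A 0) = 0"
    by (rule vanishes_triangle[OF poly_below_compose[OF G(1) A]]; rule van) (auto simp: zero_prod_def)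
  then show False
    using G(2) by (simp add: linear_0[OF A])
qed

lemma almost_4_cover_size:
  fixes M :: "(real^'n) set multiset"
  assumes M: "almost_cover 4 M" and n: "CARD('n) \<ge> 3"
  shows "CARD('n) + 5 \<le> size M"
proof (rule ccontr)
  assume small: "\<not> CARD('n) + 5 \<le> size M"
  obtain T :: "'n set" where T: "card T = 3"
    using obtain_subset_with_card_n[OF n] by blast
  then obtain i j m where ijm: "T = {i, j, m}" "i \<noteq> j" "i \<noteq> m" "j \<noteq> m"
    by (auto simp: card_3_iff)
  obtain G where G: "poly_below 8 G" "G 0 \<noteq> 0"
    "\<And>v. v \<in> cube \<Longrightarrow> v \<noteq> 0 \<Longrightarrow> (\<forall>i. i \<notin> T \<longrightarrow> v $ i = 0) \<Longrightarrow> vanishes 4 v G"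
    using almost_cover_subcube_polynomial[OF M, of 8 T] small n T by auto
  define A :: "real \<times> real \<times> real \<Rightarrow> real^'n" where
    "A = (\<lambda>z. fst z *\<^sub>R axis i 1 + fst (snd z) *\<^sub>R axis j 1 + snd (snd z) *\<^sub>R axis m 1)"
  have A: "linear A"
    by (simp add: A_def linear_iff scaleR_left_distrib scaleR_right_distrib)
  have comp: "A z $ c = (if c = i then fst z else if c = j then fst (snd z)
      else if c = m then snd (snd z) else 0)" for z c
    using ijm by (simp add: A_def axis_def)
  have van: "vanishes 4 (a, b, c) (\<lambda>z. G (0 + A z))"
    if "a \<in> {0, 1}" "b \<in> {0, 1}" "c \<in> {0, 1}" "(a, b, c) \<noteq> 0" for a b c
    using that ijm by (intro vanishes_compose[OF _ A] G(3)) (auto simp: cube_def comp vec_eq_iff zero_prod_def)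
  have "G (0 + A 0) = 0"
    by (rule vanishes_3cube[OF poly_below_compose[OF G(1) A]]; rule van) (auto simp: zero_prod_def)
  then show False
    using G(2) by (simp add: linear_0[OF A])
qed

lemma almost_cover_remove:
  fixes M :: "(real^'n) set multiset"
  assumes M: "almost_cover (Suc k) M"
  obtains M' :: "(real^'n) set multiset" where "almost_cover k M'" "size M = Suc (size M')"
proof -
  define one :: "real^'n" where "one = (\<chi> i. 1)"
  have "one \<in> cube - {0}"
    by (auto simp: one_def cube_def vec_eq_iff)
  then have "Suc k \<le> size {# H \<in># M. one \<in> H #}"
    using M unfolding almost_cover_def by blast
  then obtain H where H: "H \<in># M"
    by (cases "M = {#}") auto
  then obtain M' where M': "M = add_mset H M'"
    by (metis mset_add)
  have "k \<le> size {# K \<in># M'. v \<in> K #}" if "v \<in> cube - {0}" for v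
  proof -
    have "Suc k \<le> size {# K \<in># M. v \<in> K #}"
      using M that unfolding almost_cover_def by blast
    then show ?thesis
      unfolding M' by (auto split: if_splits)
  qed
  then have "almost_cover k M'"
    using M unfolding almost_cover_def M' by auto
  then show thesis
    using that M' by auto
qed

lemma almost_cover_size:
  fixes M :: "(real^'n) set multiset"
  assumes "almost_cover (4 + j) M" and n: "CARD('n) \<ge> 3"
  shows "CARD('n) + (4 + j) + 1 \<le> size M"
  using assms(1)
proof (induction j arbitrary: M)
  case 0
  then show ?case using almost_4_cover_size[OF _ n] by fastforce
next
  case (Suc j)
  from Suc.prems obtain M' :: "(real^'n) set multiset"
    where "almost_cover (4 + j) M'" "size M = Suc (size M')"
    unfolding add_Suc_right by (rule almost_cover_remove)
  then show ?case using Suc.IH[of M'] by simp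
qed

section \<open>An almost cover of small size\<close>

lemma size_filter_sum:
  "finite A \<Longrightarrow> size {# H \<in># (\<Sum>i\<in>A. f i). P H #} = (\<Sum>i\<in>A. size {# H \<in># f i. P H #})"
  by (induction rule: finite_induct) auto

lemma size_filter_replicate: "size {# H \<in># replicate_mset n x. P H #} = (if P x then n else 0)"
  by (induction n) auto

lemma sum_descending: "(\<Sum>j\<in>{1..<k}. k - j) = k choose 2"
proof (induction k)
  case (Suc k)
  have "(\<Sum>j\<in>{1..<Suc k}. Suc k - j) = (\<Sum>j\<in>{1..<Suc k}. (k - j) + 1)"
    by (rule sum.cong) auto
  also have "\<dots> = (\<Sum>j\<in>{1..<Suc k}. k - j) + k"
    by (simp only: sum.distrib) simp
  also have "(\<Sum>j\<in>{1..<Suc k}. k - j) = (\<Sum>j\<in>{1..<k}. k - j)"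
    by (cases "k = 0") auto
  finally show ?case
    using Suc.IH by (simp add: numeral_2_eq_2)
qed simp

lemma almost_cover_of_size:
  "\<exists>M :: (real^'n) set multiset. almost_cover k M \<and> size M = CARD('n) + (k choose 2)"
proof -
  let ?H = "\<lambda>i. {x :: real^'n. x $ i = 1}"
  let ?S = "\<lambda>j. {x :: real^'n. (\<Sum>i\<in>UNIV. x $ i) = real j}"
  define M where "M = (\<Sum>i\<in>UNIV. {#?H i#}) + (\<Sum>j\<in>{1..<k}. replicate_mset (k - j) (?S j))"
  have sz: "size {# H \<in># M. P H #} = (\<Sum>i\<in>UNIV. if P (?H i) then 1 else 0)
      + (\<Sum>j\<in>{1..<k}. if P (?S j) then k - j else 0)" for P
    by (auto simp: M_def size_filter_sum size_filter_replicate intro!: sum.cong)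
  have "size M = CARD('n) + (k choose 2)"
    using sz[of "\<lambda>_. True"] sum_descending[of k] by simp
  moreover have "almost_cover k M"
    unfolding almost_cover_def
  proof (intro conjI ballI)
    fix H assume "H \<in># M"
    then consider i where "H = ?H i" | j where "j \<ge> 1" "H = ?S j"
      by (auto simp: M_def set_mset_sum split: if_splits)
    note H = this
    show "affine_hyperplane H"
      using H
    proof cases
      case (1 i)
      then show ?thesis
        unfolding affine_hyperplane_def
        by (intro exI[of _ "axis i 1"] exI[of _ 1]) (auto simp: inner_axis' axis_eq_0_iff)
    next
      case (2 j)
      then show ?thesis
        unfolding affine_hyperplane_def
        by (intro exI[of _ "\<chi> i. 1"] exI[of _ "real j"]) (auto simp: inner_vec_def vec_eq_iff)
    qed
    show "0 \<notin> H"
      using H by cases auto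
  next
    fix v :: "real^'n"
    assume v: "v \<in> cube - {0}"
    define w where "w = card {i. v $ i = 1}"
    have v01: "v $ i = (if v $ i = 1 then 1 else 0)" for i
      using v by (auto simp: cube_def)
    have "(\<Sum>i\<in>UNIV. v $ i) = (\<Sum>i\<in>UNIV. if v $ i = 1 then 1 else 0)"
      by (rule sum.cong) (auto simp: v01[symmetric])
    then have sum: "(\<Sum>i\<in>UNIV. v $ i) = real w"
      by (simp add: w_def sum.If_cases)
    obtain i where "v $ i = 1"
      using v by (auto simp: cube_def vec_eq_iff)
    then have "w \<ge> 1"
      by (auto simp: w_def Suc_le_eq card_gt_0_iff)
    have "size {# H \<in># M. v \<in> H #} = w + (\<Sum>j\<in>{1..<k}. if w = j then k - j else 0)"
      by (simp add: sz sum w_def sum.If_cases)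
    also have "\<dots> = w + (if w < k then k - w else 0)"
      using \<open>w \<ge> 1\<close> by simp
    finally show "k \<le> size {# H \<in># M. v \<in> H #}"
      by (simp split: if_splits)
  qed
  ultimately show ?thesis by blast
qed

lemma min_almost_cover_le:
  "min_almost_cover TYPE('n::finite) k \<le> CARD('n) + (k choose 2)"
  unfolding min_almost_cover_def using almost_cover_of_size[where 'n = 'n] by (rule Least_le)

lemma min_almost_cover_attained:
  "\<exists>M :: (real^'n) set multiset. almost_cover k M \<and> size M = min_almost_cover TYPE('n::finite) k"
  unfolding min_almost_cover_def using almost_cover_of_size[where 'n = 'n] by (rule LeastI)

theorem theorem1p1:
  shows "(CARD('n::finite) \<ge> 2 \<longrightarrow> min_almost_cover TYPE('n) 3 = CARD('n) + 3) \<and>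
    (\<forall>k::nat. k \<ge> 4 \<and> CARD('n) \<ge> 3 \<longrightarrow>
      CARD('n) + k + 1 \<le> min_almost_cover TYPE('n) k \<and>
      min_almost_cover TYPE('n) k \<le> CARD('n) + (k choose 2))"
proof (intro conjI impI allI)
  assume n: "CARD('n) \<ge> 2"
  have "CARD('n) + 3 \<le> min_almost_cover TYPE('n) 3"
    using min_almost_cover_attained[where 'n = 'n and k = 3] almost_3_cover_size[OF _ n] by metis
  moreover have "(3 :: nat) choose 2 = 3"
    by (simp add: numeral_3_eq_3 numeral_2_eq_2)
  ultimately show "min_almost_cover TYPE('n) 3 = CARD('n) + 3"
    using min_almost_cover_le[where 'n = 'n and k = 3] by linarith
next
  fix k :: nat
  assume k: "k \<ge> 4 \<and> CARD('n) \<ge> 3"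
  then have "4 + (k - 4) = k" by simp
  then show "CARD('n) + k + 1 \<le> min_almost_cover TYPE('n) k"
    using min_almost_cover_attained[where 'n = 'n and k = k] almost_cover_size[of "k - 4"] k by metis
  show "min_almost_cover TYPE('n) k \<le> CARD('n) + (k choose 2)"
    by (rule min_almost_cover_le)
qed

end
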